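(* For a Tychonoff $\mu$-space $Z$ the following assertions are equivalent: (i) $Z$ is locally compact; (ii) $Z\times X$ is an Ascoli space for each Ascoli space $X$; (iii) $Z\times X$ is an Ascoli space for each Tychonoff Fréchet–Urysohn space $X$.
   Context: A subset $A$ of a space $Z$ is functionally bounded if $f(A)$ is bounded in $\mathbb{R}$ for every continuous $f:Z\to\mathbb{R}$. $Z$ is a $\mu$-space if every functionally bounded subset of $Z$ is relatively compact (has compact closure). A space $X$ is Fréchet–Urysohn if for every $A\subseteq X$ and $x\in\overline{A}$ there is a sequence in $A$ converging to $x$. A Tychonoff space $X$ is Ascoli if every compact subset $K$ of $C_k(X)$ (the space of continuous real-valued functions on $X$ with the compact-open topology) is evenly continuous, i.e. the evaluation map $X\times K\to\mathbb{R}$, $(x,f)\mapsto f(x)$, is continuous. *)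

theory Defs
  imports "HOL-Analysis.Analysis"
begin

definition Tychonoff_space :: "'a topology \<Rightarrow> bool" where
  "Tychonoff_space X \<longleftrightarrow> completely_regular_space X \<and> Hausdorff_space X"

definition functionally_bounded_in :: "'a topology \<Rightarrow> 'a set \<Rightarrow> bool" where
  "functionally_bounded_in Z A \<longleftrightarrow>
     A \<subseteq> topspace Z \<and> (\<forall>f. continuous_map Z euclideanreal f \<longrightarrow> bounded (f ` A))"

definition mu_space :: "'a topology \<Rightarrow> bool" where
  "mu_space Z \<longleftrightarrow> (\<forall>A. functionally_bounded_in Z A \<longrightarrow> compactin Z (Z closure_of A))"

definition Frechet_Urysohn_space :: "'a topology \<Rightarrow> bool" where
  "Frechet_Urysohn_space X \<longleftrightarrow>
     (\<forall>A x. A \<subseteq> topspace X \<and> x \<in> X closure_of A \<longrightarrow>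
        (\<exists>s :: nat \<Rightarrow> 'a. range s \<subseteq> A \<and> limitin X s x sequentially))"

text \<open>The restriction to \<^const>\<open>extensional\<close> functions makes every continuous function on
  \<^term>\<open>topspace X\<close> have exactly one representative, since \<^const>\<open>continuous_map\<close> ignores
  the values outside \<^term>\<open>topspace X\<close>.\<close>

definition continuous_functions :: "'a topology \<Rightarrow> ('a \<Rightarrow> real) set" where
  "continuous_functions X = {f \<in> extensional (topspace X). continuous_map X euclideanreal f}"

definition compact_open_topology :: "'a topology \<Rightarrow> ('a \<Rightarrow> real) topology" where
  "compact_open_topology X =
     topology_generated_by
       {{f \<in> continuous_functions X. f ` C \<subseteq> U} | C U. compactin X C \<and> open U}"

lemma topspace_compact_open_topology [simp]:
  "topspace (compact_open_topology X) = continuous_functions X"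
proof -
  have "{f \<in> continuous_functions X. f ` {} \<subseteq> UNIV} \<in>
      {{f \<in> continuous_functions X. f ` C \<subseteq> U} | C U. compactin X C \<and> open U}"
    using compactin_empty open_UNIV by blast
  then show ?thesis
    unfolding compact_open_topology_def topology_generated_by_topspace by auto
qed

definition evenly_continuous :: "'a topology \<Rightarrow> ('a \<Rightarrow> real) set \<Rightarrow> bool" where
  "evenly_continuous X K \<longleftrightarrow>
     continuous_map (prod_topology X (subtopology (compact_open_topology X) K)) euclideanreal
       (\<lambda>(x, f). f x)"

definition Ascoli_space :: "'a topology \<Rightarrow> bool" where
  "Ascoli_space X \<longleftrightarrow>
     Tychonoff_space X \<and>
     (\<forall>K. compactin (compact_open_topology X) K \<longrightarrow> evenly_continuous X K)"

end

(* If Z is locally compact and K is compact in C_k(Z x X), the slice map (z, f) |-> f(z, -) is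
   continuous from Z x K to C_k(X); over a compact neighbourhood C of a point of Z its image is
   compact, hence evenly continuous, and f(z, x) factors through evaluation on that image.

   If z0 has no compact neighbourhood, the mu-property gives for every open U containing z0 a
   continuous phi_U that is unbounded on U. Let X be the sequential fan with one spine
   (U, 0), (U, 1), ... for each U. The functions (z, y) |-> [y = (U, n)] * max 0 (|phi_U z| - n)
   converge to 0 in C_k(Z x X), because a compact set meets only finitely many spines and
   phi_U is bounded on its projection to Z. Evaluation on the resulting compact set is not
   continuous at ((z0, apex), 0). *)

theory Submission
  imports Defs
begin

section \<open>Continuity and the compact-open topology\<close>

lemma continuous_map_euclideanreal_iff:
  "continuous_map X euclideanreal f \<longleftrightarrow>
     (\<forall>x \<in> topspace X. \<forall>e>0. \<exists>U. openin X U \<and> x \<in> U \<and> (\<forall>y\<in>U. \<bar>f y - f x\<bar> < e))"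
  using Met_TC.continuous_map_to_metric[of X f]
  by (simp add: dist_real_def abs_minus_commute)

text \<open>Lets even continuity be checked on open boxes, over each of which the
  \<open>Z\<close>-coordinate stays inside a compact set.\<close>

lemma continuous_map_locally:
  assumes "\<And>x. x \<in> topspace X \<Longrightarrow>
    \<exists>U. openin X U \<and> x \<in> U \<and> continuous_map (subtopology X U) Y f"
  shows "continuous_map X Y f"
proof -
  obtain T where T: "\<And>x. x \<in> topspace X \<Longrightarrow>
      openin X (T x) \<and> x \<in> T x \<and> continuous_map (subtopology X (T x)) Y f"
    using assms by metis
  show ?thesis
    by (rule pasting_lemma[where I = "topspace X" and T = T and f = "\<lambda>_. f"]) (use T in blast)+
qed

lemma openin_compact_open_topology_subbasis:
  assumes "compactin X C" "open U"
  shows "openin (compact_open_topology X) {f \<in> continuous_functions X. f ` C \<subseteq> U}"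
  unfolding compact_open_topology_def
  by (rule topology_generated_by_Basis) (use assms in blast)

lemma continuous_map_into_compact_open_topology:
  assumes "\<And>y. y \<in> topspace Y \<Longrightarrow> F y \<in> continuous_functions X"
    and "\<And>C U. compactin X C \<Longrightarrow> open U \<Longrightarrow> openin Y {y \<in> topspace Y. F y ` C \<subseteq> U}"
  shows "continuous_map Y (compact_open_topology X) F"
  unfolding compact_open_topology_def
proof (rule continuous_on_generated_topo)
  fix W assume "W \<in> {{f \<in> continuous_functions X. f ` C \<subseteq> U} | C U. compactin X C \<and> open U}"
  then obtain C U where CU: "W = {f \<in> continuous_functions X. f ` C \<subseteq> U}" "compactin X C" "open U"
    by blast
  then have "F -` W \<inter> topspace Y = {y \<in> topspace Y. F y ` C \<subseteq> U}"
    using assms(1) by auto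
  then show "openin Y (F -` W \<inter> topspace Y)"
    using assms(2) CU by simp
next
  have "F ` topspace Y \<subseteq> topspace (compact_open_topology X)"
    using assms(1) by auto
  then show "F ` topspace Y \<subseteq> \<Union> {{f \<in> continuous_functions X. f ` C \<subseteq> U} | C U. compactin X C \<and> open U}"
    by (simp only: compact_open_topology_def topology_generated_by_topspace)
qed

section \<open>Products with a locally compact factor\<close>

lemma Tychonoff_space_prod_topology:
  assumes "Tychonoff_space X" "Tychonoff_space Y"
  shows "Tychonoff_space (prod_topology X Y)"
  using assms
  by (simp add: Tychonoff_space_def completely_regular_space_prod_topology
      Hausdorff_space_prod_topology)

text \<open>If f maps {z} \<times> C into U, the tube lemma gives an open A around z with f mapping
  A \<times> C into U. The compact-open topology controls functions near f only over compact sets,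
  so a compact neighbourhood D of z is fitted inside A. Every g mapping the compact set D \<times> C
  into U then has all its slices over D mapping C into U.\<close>

lemma continuous_map_slice:
  assumes Z: "neighbourhood_base_of (compactin Z) Z"
  shows "continuous_map
    (prod_topology Z (compact_open_topology (prod_topology Z X)))
    (compact_open_topology X) (\<lambda>(z, f). restrict (\<lambda>x. f (z, x)) (topspace X))"
    (is "continuous_map ?P _ ?\<Phi>")
proof (rule continuous_map_into_compact_open_topology)
  let ?ZX = "prod_topology Z X"
  fix y assume "y \<in> topspace ?P"
  then obtain z f where y: "y = (z, f)" "z \<in> topspace Z" "continuous_map ?ZX euclideanreal f"
    by (auto simp: continuous_functions_def)
  then have "continuous_map X euclideanreal (f \<circ> (\<lambda>x. (z, x)))"
    by (intro continuous_map_compose[of X ?ZX]) (auto simp: continuous_map_pairwise o_def)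
  then have "continuous_map X euclideanreal (restrict (\<lambda>x. f (z, x)) (topspace X))"
    by (rule continuous_map_eq) auto
  then show "?\<Phi> y \<in> continuous_functions X"
    by (simp add: continuous_functions_def y)
next
  let ?ZX = "prod_topology Z X"
  fix C and U :: "real set" assume C: "compactin X C" and U: "open U"
  have CX: "C \<subseteq> topspace X"
    using C by (rule compactin_subset_topspace)
  show "openin ?P {y \<in> topspace ?P. ?\<Phi> y ` C \<subseteq> U}"
  proof (subst openin_subopen, intro ballI)
    fix y assume "y \<in> {y \<in> topspace ?P. ?\<Phi> y ` C \<subseteq> U}"
    then obtain z f where y: "y = (z, f)" "z \<in> topspace Z" "f \<in> continuous_functions ?ZX"
      "\<And>x. x \<in> C \<Longrightarrow> f (z, x) \<in> U"
      using CX by (force simp: image_subset_iff)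
    then have "openin ?ZX {q \<in> topspace ?ZX. f q \<in> U}"
      using U by (intro openin_continuous_map_preimage[of _ euclideanreal])
        (auto simp: continuous_functions_def)
    then obtain A B where AB: "openin Z A" "openin X B" "z \<in> A" "C \<subseteq> B"
      "A \<times> B \<subseteq> {q \<in> topspace ?ZX. f q \<in> U}"
      using tube_lemma_right[OF _ C y(2), of "{q \<in> topspace ?ZX. f q \<in> U}"] y CX by force
    then obtain A' D where A': "openin Z A'" "compactin Z D" "z \<in> A'" "A' \<subseteq> D" "D \<subseteq> A"
      using Z unfolding neighbourhood_base_of by meson
    define G where "G = {g \<in> continuous_functions ?ZX. g ` (D \<times> C) \<subseteq> U}"
    have "openin (compact_open_topology ?ZX) G"
      unfolding G_def using A' C U
      by (intro openin_compact_open_topology_subbasis) (auto simp: compactin_Times)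
    then have "openin ?P (A' \<times> G)"
      using A' by (simp add: openin_prod_Times_iff)
    moreover have "f (a, x) \<in> U" if "a \<in> D" "x \<in> C" for a x
      using that A' AB by blast
    then have "y \<in> A' \<times> G"
      using y A' by (auto simp: G_def)
    moreover have "A' \<times> G \<subseteq> {y \<in> topspace ?P. ?\<Phi> y ` C \<subseteq> U}"
      using subsetD[OF A'(4)] subsetD[OF CX] subsetD[OF openin_subset[OF A'(1)]]
      by (auto simp: G_def image_subset_iff)
    ultimately show "\<exists>T. openin ?P T \<and> y \<in> T \<and> T \<subseteq> {y \<in> topspace ?P. ?\<Phi> y ` C \<subseteq> U}"
      by blast
  qed
qed

lemma Ascoli_space_prod_locally_compact:
  assumes Z: "Tychonoff_space Z" "locally_compact_space Z" and X: "Ascoli_space X"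
  shows "Ascoli_space (prod_topology Z X)"
  unfolding Ascoli_space_def
proof (intro conjI allI impI)
  show "Tychonoff_space (prod_topology Z X)"
    using assms by (simp add: Ascoli_space_def Tychonoff_space_prod_topology)
next
  let ?ZX = "prod_topology Z X"
  fix K assume K: "compactin (compact_open_topology ?ZX) K"
  let ?CK = "subtopology (compact_open_topology ?ZX) K"
  define \<Phi> where "\<Phi> = (\<lambda>(z, f :: 'a \<times> 'b \<Rightarrow> real). restrict (\<lambda>x. f (z, x)) (topspace X))"
  have nb: "neighbourhood_base_of (compactin Z) Z"
    using Z by (simp add: Tychonoff_space_def locally_compact_space_neighbourhood_base)
  have \<Phi>: "continuous_map (prod_topology Z (compact_open_topology ?ZX)) (compact_open_topology X) \<Phi>"
    unfolding \<Phi>_def by (rule continuous_map_slice[OF nb])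
  show "evenly_continuous ?ZX K"
    unfolding evenly_continuous_def
  proof (rule continuous_map_locally)
    fix w assume w: "w \<in> topspace (prod_topology ?ZX ?CK)"
    then obtain z x f where w_eq: "w = ((z, x), f)" by (metis prod.exhaust)
    then have "z \<in> topspace Z" using w by simp
    then obtain U C where UC: "openin Z U" "compactin Z C" "z \<in> U" "U \<subseteq> C"
      using Z unfolding locally_compact_space_def by blast
    define L where "L = \<Phi> ` (C \<times> K)"
    have "compactin (compact_open_topology X) L"
      unfolding L_def using UC K by (intro image_compactin[OF _ \<Phi>]) (simp add: compactin_Times)
    then have ev: "continuous_map (prod_topology X (subtopology (compact_open_topology X) L))
        euclideanreal (\<lambda>(x, f). f x)"
      using X by (simp add: Ascoli_space_def evenly_continuous_def)
    \<comment> \<open>Confining the first coordinate to \<open>U\<close>, which lies in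
      \<open>C\<close>, forces all slices over \<open>W\<close> into the single compact set
      \<open>L\<close>.\<close>
    define W where "W = (U \<times> topspace X) \<times> topspace ?CK"
    let ?S = "subtopology (prod_topology ?ZX ?CK) W"
    have W: "openin (prod_topology ?ZX ?CK) W"
      unfolding W_def by (simp only: openin_prod_Times_iff openin_topspace UC simp_thms)
    have pr: "continuous_map ?S Z (\<lambda>q. fst (fst q))" "continuous_map ?S X (\<lambda>q. snd (fst q))"
      "continuous_map ?S (compact_open_topology ?ZX) (\<lambda>q. snd q)"
    proof -
      have 1: "continuous_map ?S ?ZX fst" "continuous_map ?S ?CK snd"
        by (auto intro: continuous_map_from_subtopology continuous_map_fst continuous_map_snd)
      show "continuous_map ?S Z (\<lambda>q. fst (fst q))" "continuous_map ?S X (\<lambda>q. snd (fst q))"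
        using 1(1) by (auto simp: continuous_map_pairwise o_def)
      show "continuous_map ?S (compact_open_topology ?ZX) (\<lambda>q. snd q)"
        using 1(2) by (simp add: continuous_map_in_subtopology)
    qed
    have "continuous_map ?S (prod_topology Z (compact_open_topology ?ZX)) (\<lambda>q. (fst (fst q), snd q))"
      using pr by (simp add: continuous_map_pairwise o_def)
    then have "continuous_map ?S (compact_open_topology X) (\<lambda>q. \<Phi> (fst (fst q), snd q))"
      using continuous_map_compose[OF _ \<Phi>] by (simp add: o_def)
    moreover have "(\<lambda>q. \<Phi> (fst (fst q), snd q)) \<in> topspace ?S \<rightarrow> L"
      using UC by (auto simp: L_def W_def)
    ultimately have "continuous_map ?S (subtopology (compact_open_topology X) L)
        (\<lambda>q. \<Phi> (fst (fst q), snd q))"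
      by (simp add: continuous_map_in_subtopology image_subset_iff_funcset)
    then have "continuous_map ?S (prod_topology X (subtopology (compact_open_topology X) L))
        (\<lambda>q. (snd (fst q), \<Phi> (fst (fst q), snd q)))"
      using pr by (simp add: continuous_map_pairwise o_def)
    from continuous_map_compose[OF this ev]
    have "continuous_map ?S euclideanreal (\<lambda>q. \<Phi> (fst (fst q), snd q) (snd (fst q)))"
      by (simp add: o_def)
    \<comment> \<open>On \<open>W\<close> the second coordinate lies in \<open>topspace X\<close>,
      where the \<open>restrict\<close> inside \<open>\<Phi>\<close> changes nothing.\<close>
    then have "continuous_map ?S euclideanreal (\<lambda>(q, f). f q)"
      by (rule continuous_map_eq) (auto simp: \<Phi>_def)
    moreover have "w \<in> W"
      using w UC by (auto simp: W_def w_eq)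
    ultimately show "\<exists>W. openin (prod_topology ?ZX ?CK) W \<and> w \<in> W \<and>
        continuous_map (subtopology (prod_topology ?ZX ?CK) W) euclideanreal (\<lambda>(q, f). f q)"
      using W by blast
  qed
qed

section \<open>Frechet-Urysohn spaces\<close>

lemma compactin_sequence_tail_with_limit:
  assumes "limitin X a x sequentially" "range a \<subseteq> topspace X"
  shows "compactin X (insert x (a ` {N..}))"
  using assms by (intro compactin_sequence_with_limit) auto

text \<open>Otherwise the points at which some member of \<open>K\<close> differs from its value at
  \<open>x\<close> by at least \<open>e\<close> accumulate at \<open>x\<close>, and a sequence
  \<open>a\<close> of them converges to \<open>x\<close>. Each g in \<open>K\<close> is almost
  constant on \<open>x\<close> together with some tail of \<open>a\<close>, a compact set. By
  compactness of \<open>K\<close>, finitely many tails serve all of \<open>K\<close>, which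
  contradicts the choice of the sequence.\<close>

lemma Frechet_Urysohn_equicontinuous:
  assumes FU: "Frechet_Urysohn_space X" and K: "compactin (compact_open_topology X) K"
    and x: "x \<in> topspace X" and e: "e > 0"
  shows "\<exists>U. openin X U \<and> x \<in> U \<and> (\<forall>y\<in>U. \<forall>f\<in>K. \<bar>f y - f x\<bar> < e)"
proof -
  define A where "A = {y \<in> topspace X. \<exists>f\<in>K. \<bar>f y - f x\<bar> \<ge> e}"
  have KC: "K \<subseteq> continuous_functions X"
    using compactin_subset_topspace[OF K] by simp
  have "x \<notin> X closure_of A"
  proof
    assume "x \<in> X closure_of A"
    then obtain a where a: "range a \<subseteq> A" "limitin X a x sequentially"
      using FU unfolding Frechet_Urysohn_space_def A_def by (metis (no_types, lifting) mem_Collect_eq subsetI)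
    then have "\<forall>n. \<exists>f\<in>K. \<bar>f (a n) - f x\<bar> \<ge> e"
      by (auto simp: A_def)
    then obtain f where f: "\<And>n. f n \<in> K" "\<And>n. \<bar>f n (a n) - f n x\<bar> \<ge> e"
      by metis
    have aX: "range a \<subseteq> topspace X"
      using a by (auto simp: A_def)
    \<comment> \<open>The centre \<open>u\<close> is a free parameter, so that \<open>G N u\<close>
      does not refer to a particular function. Radius \<open>e/2\<close> makes any two values in the
      ball differ by less than \<open>e\<close>.\<close>
    define G where "G N u = {h \<in> continuous_functions X. h ` insert x (a ` {N..}) \<subseteq> ball u (e/2)}"
      for N :: nat and u :: real
    have G_open: "openin (compact_open_topology X) (G N u)" for N u
      unfolding G_def
      by (intro openin_compact_open_topology_subbasis compactin_sequence_tail_with_limit a aX) auto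
    have "\<exists>N. g \<in> G N (g x)" if "g \<in> K" for g
    proof -
      have "limitin euclideanreal (g \<circ> a) (g x) sequentially"
        using that KC a by (intro continuous_map_limit) (auto simp: continuous_functions_def)
      then obtain N where "\<forall>n\<ge>N. dist (g (a n)) (g x) < e/2"
        using e by (auto simp: lim_sequentially dest: half_gt_zero)
      then show ?thesis
        using that KC e by (intro exI[of _ N]) (auto simp: G_def dist_commute)
    qed
    then have "K \<subseteq> \<Union> (range (\<lambda>(N, u). G N u))"
      by force
    moreover have "\<forall>V \<in> range (\<lambda>(N, u). G N u). openin (compact_open_topology X) V"
      using G_open by auto
    ultimately obtain \<F> where "finite \<F>" "\<F> \<subseteq> range (\<lambda>(N, u). G N u)" "K \<subseteq> \<Union>\<F>"
      using K unfolding compactin_def by meson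
    then obtain I where I: "finite I" "K \<subseteq> (\<Union>(N, u)\<in>I. G N u)"
      by (metis finite_subset_image)
    \<comment> \<open>Past every tail index of the finite subcover, \<open>a M\<close> lies in the
      tail belonging to whichever \<open>G N u\<close> contains \<open>f M\<close>. Inserting 0
      keeps the set under \<open>Max\<close> nonempty.\<close>
    define M where "M = Max (insert 0 (fst ` I))"
    obtain N u where Nu: "(N, u) \<in> I" "f M \<in> G N u"
      using I f(1)[of M] by blast
    have "N \<le> M"
      using I Nu unfolding M_def by (intro Max_ge) force+
    then have "f M (a M) \<in> ball u (e/2)" "f M x \<in> ball u (e/2)"
      using Nu by (auto simp: G_def image_subset_iff)
    then have "\<bar>f M (a M) - f M x\<bar> < e"
      unfolding mem_ball dist_real_def by linarith
    then show False
      using f(2)[of M] by simp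
  qed
  then obtain U where U: "openin X U" "x \<in> U" "U \<inter> A = {}"
    using x by (auto simp: in_closure_of)
  have "\<bar>f y - f x\<bar> < e" if "y \<in> U" "f \<in> K" for y f
  proof (rule ccontr)
    assume "\<not> \<bar>f y - f x\<bar> < e"
    then have "y \<in> A"
      using that subsetD[OF openin_subset[OF U(1)] that(1)] by (auto simp: A_def not_less)
    then show False
      using U(3) that(1) by blast
  qed
  then show ?thesis
    using U(1,2) by blast
qed

text \<open>Split |h y - f x| at h x: equicontinuity of \<open>K\<close> at \<open>x\<close> bounds
  the first part, and a compact-open neighbourhood of f over the compact set {x} bounds the
  second.\<close>

lemma Frechet_Urysohn_imp_Ascoli_space:
  assumes "Tychonoff_space X" "Frechet_Urysohn_space X"
  shows "Ascoli_space X"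
  unfolding Ascoli_space_def
proof (intro conjI allI impI)
  fix K
  let ?CK = "subtopology (compact_open_topology X) K"
  assume K: "compactin (compact_open_topology X) K"
  show "evenly_continuous X K"
    unfolding evenly_continuous_def continuous_map_euclideanreal_iff
  proof (intro ballI allI impI)
    fix w and e :: real assume w: "w \<in> topspace (prod_topology X ?CK)" and e: "e > 0"
    then obtain x f where xf: "w = (x, f)" "x \<in> topspace X" "f \<in> K" "f \<in> continuous_functions X"
      by auto
    obtain U where U: "openin X U" "x \<in> U" "\<forall>y\<in>U. \<forall>f\<in>K. \<bar>f y - f x\<bar> < e/2"
      using Frechet_Urysohn_equicontinuous[OF assms(2) K xf(2), of "e/2"] e by auto
    define G where "G = {h \<in> continuous_functions X. h ` {x} \<subseteq> ball (f x) (e/2)}"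
    have "openin (compact_open_topology X) G"
      unfolding G_def by (intro openin_compact_open_topology_subbasis) (auto simp: xf)
    then have "openin (prod_topology X ?CK) (U \<times> (G \<inter> K))"
      using U by (auto simp: openin_prod_Times_iff openin_subtopology)
    moreover have "w \<in> U \<times> (G \<inter> K)"
      using xf U e by (auto simp: G_def)
    moreover have "\<bar>h y - f x\<bar> < e" if "y \<in> U" "h \<in> G \<inter> K" for y h
    proof -
      have "\<bar>h y - h x\<bar> < e/2" using U that by blast
      moreover have "\<bar>h x - f x\<bar> < e/2" using that by (auto simp: G_def dist_real_def abs_minus_commute)
      ultimately show ?thesis by linarith
    qed
    ultimately show "\<exists>W. openin (prod_topology X ?CK) W \<and> w \<in> W \<and>
        (\<forall>v\<in>W. \<bar>(case v of (x, f) \<Rightarrow> f x) - (case w of (x, f) \<Rightarrow> f x)\<bar> < e)"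
      by (intro exI[of _ "U \<times> (G \<inter> K)"]) (auto simp: xf)
  qed
qed (rule assms)

section \<open>Fans\<close>

text \<open>The sequential fan with isolated points \<open>S\<close>, apex \<open>p\<close> and the fibres of \<open>c\<close> as spines.
  If \<open>c\<close> is constant, this is the one-point compactification of the discrete space \<open>S\<close>.\<close>

definition fan :: "'b set \<Rightarrow> 'b \<Rightarrow> ('b \<Rightarrow> 'i) \<Rightarrow> 'b topology" where
  "fan S p c = topology (\<lambda>V. V \<subseteq> insert p S \<and> (p \<in> V \<longrightarrow> (\<forall>i. finite {x \<in> S - V. c x = i})))"

lemma openin_fan:
  "openin (fan S p c) V \<longleftrightarrow> V \<subseteq> insert p S \<and> (p \<in> V \<longrightarrow> (\<forall>i. finite {x \<in> S - V. c x = i}))"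
proof -
  have "istopology (\<lambda>V. V \<subseteq> insert p S \<and> (p \<in> V \<longrightarrow> (\<forall>i. finite {x \<in> S - V. c x = i})))"
    unfolding istopology_def
  proof (intro conjI allI impI; (elim conjE)?)
    fix V W
    assume *: "p \<in> V \<longrightarrow> (\<forall>i. finite {x \<in> S - V. c x = i})"
      "p \<in> W \<longrightarrow> (\<forall>i. finite {x \<in> S - W. c x = i})" "p \<in> V \<inter> W"
    fix i
    have "{x \<in> S - V \<inter> W. c x = i} = {x \<in> S - V. c x = i} \<union> {x \<in> S - W. c x = i}"
      by auto
    then show "finite {x \<in> S - V \<inter> W. c x = i}"
      using * by simp
  next
    fix \<V> i
    assume *: "\<forall>V\<in>\<V>. V \<subseteq> insert p S \<and> (p \<in> V \<longrightarrow> (\<forall>i. finite {x \<in> S - V. c x = i}))" "p \<in> \<Union>\<V>"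
    then obtain V where "V \<in> \<V>" "finite {x \<in> S - V. c x = i}"
      by blast
    then show "finite {x \<in> S - \<Union>\<V>. c x = i}"
      by (elim rev_finite_subset) blast
  qed auto
  then show ?thesis
    by (simp add: fan_def topology_inverse')
qed

lemma topspace_fan [simp]: "topspace (fan S p c) = insert p S"
proof (rule antisym)
  show "insert p S \<subseteq> topspace (fan S p c)"
    by (intro openin_subset) (simp add: openin_fan Diff_eq_empty_iff[THEN iffD2, OF subset_insertI])
  show "topspace (fan S p c) \<subseteq> insert p S"
    using openin_topspace[of "fan S p c"] unfolding openin_fan by blast
qed

text \<open>The complement omits the apex, and every set of isolated points is open.\<close>

lemma closedin_fan_if_openin:
  assumes "openin (fan S p c) V" "p \<in> V"
  shows "closedin (fan S p c) V"
  using assms by (auto simp: closedin_def openin_fan)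

lemma isolated_fan:
  assumes "x \<in> S" "x \<noteq> p"
  shows "openin (fan S p c) {x}" "closedin (fan S p c) {x}"
proof -
  show "openin (fan S p c) {x}"
    using assms by (simp add: openin_fan)
  have "finite {y \<in> S - (insert p S - {x}). c y = i}" for i
    by (rule finite_subset[of _ "{x}"]) auto
  then show "closedin (fan S p c) {x}"
    using assms by (simp add: closedin_def openin_fan)
qed

text \<open>The first form separates a point from a closed set in the fan; the second cuts a
  function on the product down to one isolated point of the fan.\<close>

lemma continuous_map_clopen_indicator:
  assumes "openin X V" "closedin X V"
  shows "continuous_map X euclideanreal (\<lambda>x. if x \<in> V then 0 else 1)"
    and "continuous_map X euclideanreal (\<lambda>x. if x \<in> V then 1 else 0)"
proof -
  have *: "openin X {x \<in> topspace X. (if x \<in> V then a else b) \<in> U}" for a b :: real and U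
  proof -
    have "{x \<in> topspace X. (if x \<in> V then a else b) \<in> U} =
        (if a \<in> U then V else {}) \<union> (if b \<in> U then topspace X - V else {})"
      using openin_subset[OF assms(1)] by auto
    then show ?thesis
      using assms by (auto simp: closedin_def)
  qed
  show "continuous_map X euclideanreal (\<lambda>x. if x \<in> V then 0 else 1)"
    "continuous_map X euclideanreal (\<lambda>x. if x \<in> V then 1 else 0)"
    using *[of 0 1] *[of 1 0] by (auto simp: continuous_map_def)
qed

text \<open>The clopen sets form a base: open sets around the apex are clopen, and so are the other
  singletons.\<close>

lemma Tychonoff_space_fan:
  "Tychonoff_space (fan S p c)"
proof -
  let ?X = "fan S p c"
  have clopen: "\<exists>V. openin ?X V \<and> closedin ?X V \<and> x \<in> V \<and> V \<subseteq> W" if "openin ?X W" "x \<in> W" for W x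
  proof (cases "x = p")
    case True
    then show ?thesis using that closedin_fan_if_openin[of S p c W] by (intro exI[of _ W]) auto
  next
    case False
    moreover have "x \<in> S" using that False by (auto simp: openin_fan)
    ultimately show ?thesis using isolated_fan[of x S p c] that by (intro exI[of _ "{x}"]) auto
  qed
  have cr: "completely_regular_space ?X"
    unfolding completely_regular_space_alt'
  proof (intro allI impI)
    fix W x assume "openin ?X W" "x \<in> W"
    then obtain V where "openin ?X V" "closedin ?X V" "x \<in> V" "V \<subseteq> W"
      using clopen by metis
    then show "\<exists>f. continuous_map ?X euclideanreal f \<and> f x = 0 \<and> f ` (topspace ?X - W) \<subseteq> {1}"
      by (intro exI[of _ "\<lambda>x. if x \<in> V then 0 else 1"])
        (use continuous_map_clopen_indicator in auto)
  qed
  have sep: "\<exists>U V. openin ?X U \<and> openin ?X V \<and> x \<in> U \<and> y \<in> V \<and> disjnt U V"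
    if "x \<in> S" "x \<noteq> p" "y \<in> insert p S" "x \<noteq> y" for x y
    using isolated_fan[of x S p c] that
    by (intro exI[of _ "{x}"] exI[of _ "insert p S - {x}"]) (auto simp: closedin_def)
  have "Hausdorff_space ?X"
    unfolding Hausdorff_space_def
  proof (intro allI impI)
    fix x y assume xy: "x \<in> topspace ?X \<and> y \<in> topspace ?X \<and> x \<noteq> y"
    show "\<exists>U V. openin ?X U \<and> openin ?X V \<and> x \<in> U \<and> y \<in> V \<and> disjnt U V"
    proof (cases "x = p")
      case True
      then show ?thesis using sep[of y x] xy by (metis disjnt_sym insert_iff topspace_fan)
    next
      case False
      then show ?thesis using sep[of x y] xy by auto
    qed
  qed
  with cr show ?thesis by (simp add: Tychonoff_space_def)
qed

text \<open>Only the apex can be adherent to a set \<open>A\<close> without belonging to it. Then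
  the complement of \<open>A\<close> is not open, so \<open>A\<close> contains infinitely many
  points of one spine. Any injective sequence of these converges to the apex, since a neighbourhood
  of the apex omits only finitely many points of that spine.\<close>

lemma Frechet_Urysohn_space_fan:
  "Frechet_Urysohn_space (fan S p c)"
  unfolding Frechet_Urysohn_space_def
proof (intro allI impI, elim conjE)
  let ?X = "fan S p c"
  fix A x assume A: "A \<subseteq> topspace ?X" and x: "x \<in> ?X closure_of A"
  have xX: "x \<in> insert p S" using x by (auto simp: in_closure_of)
  show "\<exists>s :: nat \<Rightarrow> 'a. range s \<subseteq> A \<and> limitin ?X s x sequentially"
  proof (cases "x \<in> A")
    case True
    then show ?thesis
      using xX by (intro exI[of _ "\<lambda>_. x"]) (auto simp: limitin_def)
  next
    case False
    have [simp]: "x = p"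
    proof (rule ccontr)
      assume "x \<noteq> p"
      then have "openin ?X {x}" using xX by (intro isolated_fan) auto
      then show False using x False by (auto simp: in_closure_of)
    qed
    have "\<not> openin ?X (insert p S - A)"
    proof
      assume "openin ?X (insert p S - A)"
      moreover have "x \<in> insert p S - A" using False by simp
      ultimately show False using x by (metis DiffD2 in_closure_of)
    qed
    then obtain i where "infinite {x \<in> S - (insert p S - A). c x = i}"
      unfolding openin_fan by blast
    moreover have "{x \<in> S - (insert p S - A). c x = i} = {x \<in> S \<inter> A. c x = i}"
      by blast
    ultimately have "infinite {x \<in> S \<inter> A. c x = i}"
      by simp
    then obtain s :: "nat \<Rightarrow> 'a" where s: "inj s" "range s \<subseteq> {x \<in> S \<inter> A. c x = i}"
      by (auto dest: infinite_countable_subset)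
    have "eventually (\<lambda>n. s n \<in> U) sequentially" if "openin ?X U" "p \<in> U" for U
    proof -
      have "finite {x \<in> S - U. c x = i}" using that by (auto simp: openin_fan)
      then have "finite (s -` {x \<in> S - U. c x = i})"
        using s(1) by (rule finite_vimageI)
      moreover have "s -` {x \<in> S - U. c x = i} = {n. s n \<notin> U}"
        using s(2) by auto
      ultimately show ?thesis
        by (simp add: eventually_cofinite flip: cofinite_eq_sequentially)
    qed
    then show ?thesis
      using s(2) by (intro exI[of _ s]) (auto simp: limitin_def)
  qed
qed

text \<open>Pick a set \<open>D\<close> with one point of \<open>C\<close> on each spine that
  \<open>C\<close> meets. Removing all of \<open>D\<close> except at most one point leaves an open
  set, because \<open>D\<close> meets each spine at most once. These open sets cover
  \<open>C\<close> and each contains at most one point of \<open>D\<close>, so a finite subcover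
  makes \<open>D\<close> finite.\<close>

lemma finite_spines_compactin_fan:
  assumes C: "compactin (fan S p c) C" and p: "p \<notin> S"
  shows "finite (c ` (C \<inter> S))"
proof -
  obtain D where D: "D \<subseteq> C \<inter> S" "inj_on c D" "c ` D = c ` (C \<inter> S)"
    using subset_image_inj[of "c ` (C \<inter> S)" c "C \<inter> S"] by auto
  define V where "V d = insert p S - (D - {d})" for d
  have "openin (fan S p c) (V d)" for d
  proof -
    have "finite {x \<in> S - V d. c x = i}" for i
    proof (rule finite_subset)
      show "{x \<in> S - V d. c x = i} \<subseteq> D \<inter> c -` {i}"
        by (auto simp: V_def)
      show "finite (D \<inter> c -` {i})"
        using finite_vimage_IntI[OF _ D(2), of "{i}"] by (simp add: Int_commute)
    qed
    then show ?thesis by (auto simp: openin_fan V_def)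
  qed
  moreover have "C \<subseteq> \<Union> (range V)"
  proof
    fix x assume "x \<in> C"
    then have "x \<in> V x"
      using compactin_subset_topspace[OF C] by (auto simp: V_def)
    then show "x \<in> \<Union> (range V)" by blast
  qed
  ultimately obtain \<F> where "finite \<F>" "\<F> \<subseteq> range V" "C \<subseteq> \<Union>\<F>"
    using C unfolding compactin_def by (metis (mono_tags, lifting) rangeE)
  then obtain I where I: "finite I" "C \<subseteq> (\<Union>d\<in>I. V d)"
    by (metis finite_subset_image)
  have "D \<subseteq> I"
  proof
    fix x assume x: "x \<in> D"
    then obtain d where "d \<in> I" "x \<in> V d" using D(1) I(2) by blast
    then show "x \<in> I" using x by (auto simp: V_def)
  qed
  then have "finite D"
    using I(1) finite_subset by blast
  then show ?thesis
    using D(3) by (metis finite_imageI)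
qed

text \<open>With a single spine, neighbourhoods of the apex are cofinite. This space will index a
  family of functions converging to the one at the apex, whose image is then compact.\<close>

lemma compact_space_fan_const:
  "compact_space (fan S p (\<lambda>_. ()))"
  unfolding compact_space_def compactin_def
proof (intro conjI allI impI; (elim conjE)?)
  let ?X = "fan S p (\<lambda>_. ())"
  fix \<U> assume \<U>: "\<forall>U\<in>\<U>. openin ?X U" "topspace ?X \<subseteq> \<Union>\<U>"
  then obtain U where U: "U \<in> \<U>" "p \<in> U" by auto
  then have fin: "finite (S - U)"
    using \<U> by (auto simp: openin_fan set_diff_eq)
  have "\<forall>x \<in> S - U. \<exists>V. V \<in> \<U> \<and> x \<in> V"
    using \<U>(2) by auto
  then obtain V where "\<And>x. x \<in> S - U \<Longrightarrow> V x \<in> \<U> \<and> x \<in> V x"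
    by metis
  then show "\<exists>\<F>. finite \<F> \<and> \<F> \<subseteq> \<U> \<and> topspace ?X \<subseteq> \<Union>\<F>"
    using fin U by (intro exI[of _ "insert U (V ` (S - U))"]) auto
qed simp

section \<open>A non-Ascoli product\<close>

lemma not_Ascoli_space_prod_fan:
  fixes Z :: "'a topology" and S :: "'b set" and c :: "'b \<Rightarrow> 'a set" and d :: "'b \<Rightarrow> nat"
  assumes z0: "z0 \<in> topspace Z"
    and \<phi>: "\<And>U. continuous_map Z euclideanreal (\<phi> U)"
    and unb: "\<And>U. openin Z U \<Longrightarrow> z0 \<in> U \<Longrightarrow> \<not> bounded (\<phi> U ` U)"
    and p: "p \<notin> S"
    and inj: "inj_on (\<lambda>x. (c x, d x)) S"
    and spine: "\<And>U. openin Z U \<Longrightarrow> z0 \<in> U \<Longrightarrow> infinite {x \<in> S. c x = U}"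
  shows "\<not> Ascoli_space (prod_topology Z (fan S p c))"
proof
  \<comment> \<open>Both fans live on the same points: \<open>?X\<close> is the factor of the
    product, while \<open>?Y\<close> indexes the functions. This permits evaluating the function
    with index x at the point x of \<open>?X\<close>.\<close>
  let ?X = "fan S p c" and ?Y = "fan S p (\<lambda>_. ())"
  let ?ZX = "prod_topology Z ?X"
  assume "Ascoli_space ?ZX"
  \<comment> \<open>Intersecting with \<open>S\<close> makes \<open>h p\<close> the zero function,
    as \<open>p\<close> is not in \<open>S\<close>, so one formula also covers the limit. The cutoff
    at \<open>d x\<close> makes \<open>h x\<close> vanish wherever |\<phi> (c x)| is at most
    \<open>d x\<close>.\<close>
  define h where "h x = (\<lambda>(z, y). (if y \<in> {x} \<inter> S then 1 else 0) * max 0 (\<bar>\<phi> (c x) z\<bar> - real (d x)))" for x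
  define F where "F x = restrict (h x) (topspace ?ZX)" for x
  have F_cont: "F x \<in> continuous_functions ?ZX" for x
  proof -
    have "openin ?X ({x} \<inter> S) \<and> closedin ?X ({x} \<inter> S)"
      using isolated_fan[of x S p c] p by (cases "x \<in> S") auto
    then have 1: "continuous_map ?X euclideanreal (\<lambda>y. if y \<in> {x} \<inter> S then 1 else 0)"
      by (intro continuous_map_clopen_indicator) auto
    have "continuous_map ?ZX euclideanreal (\<lambda>q. if snd q \<in> {x} \<inter> S then 1 else 0)"
      using continuous_map_compose[OF continuous_map_snd 1] by (simp add: o_def)
    moreover have "continuous_map ?ZX euclideanreal (\<lambda>q. \<phi> (c x) (fst q))"
      using continuous_map_compose[OF continuous_map_fst \<phi>] by (simp add: o_def)
    ultimately have "continuous_map ?ZX euclideanreal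
        (\<lambda>q. (if snd q \<in> {x} \<inter> S then 1 else 0) * max 0 (\<bar>\<phi> (c x) (fst q)\<bar> - real (d x)))"
      by (intro continuous_intros) auto
    then have "continuous_map ?ZX euclideanreal (F x)"
      by (rule continuous_map_eq) (auto simp: F_def h_def)
    then show ?thesis
      by (simp add: continuous_functions_def F_def)
  qed
  have finite_support: "finite {x \<in> S. \<exists>q\<in>C. F x q \<noteq> 0}" if C: "compactin ?ZX C" for C
  proof -
    have C1: "compactin Z (fst ` C)" and C2: "compactin ?X (snd ` C)"
      using C image_compactin continuous_map_fst continuous_map_snd by blast+
    have "\<exists>N. \<forall>z \<in> fst ` C. \<bar>\<phi> U z\<bar> \<le> real N" for U
    proof -
      have "compactin euclideanreal (\<phi> U ` fst ` C)"
        using image_compactin[OF C1 \<phi>] .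
      then have "bounded (\<phi> U ` fst ` C)"
        by (simp add: compact_imp_bounded)
      then obtain b where "\<forall>z \<in> fst ` C. \<bar>\<phi> U z\<bar> \<le> b"
        by (auto simp: bounded_iff)
      then show ?thesis
        by (meson order_trans real_arch_simple)
    qed
    then obtain N where N: "\<And>U z. z \<in> fst ` C \<Longrightarrow> \<bar>\<phi> U z\<bar> \<le> real (N U)"
      by metis
    \<comment> \<open>These are the only possible coordinates of a point \<open>x\<close> with
      \<open>F x\<close> nonzero somewhere on \<open>C\<close>: its spine meets the projection of
      \<open>C\<close>, and \<open>d x\<close> is below the bound for that spine. Injectivity of the
      coordinates turns finiteness of \<open>?I\<close> into finiteness of the set of such
      points.\<close>
    let ?I = "Sigma (c ` (snd ` C \<inter> S)) (\<lambda>U. {..N U})"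
    have "finite ?I"
      using finite_spines_compactin_fan[OF C2 p] by auto
    then have "finite ((\<lambda>x. (c x, d x)) -` ?I \<inter> S)"
      using inj by (rule finite_vimage_IntI)
    moreover have "{x \<in> S. \<exists>q\<in>C. F x q \<noteq> 0} \<subseteq> (\<lambda>x. (c x, d x)) -` ?I \<inter> S"
    proof
      fix x assume "x \<in> {x \<in> S. \<exists>q\<in>C. F x q \<noteq> 0}"
      then obtain z y where x: "x \<in> S" and zy: "(z, y) \<in> C" and nz: "F x (z, y) \<noteq> 0"
        by auto
      have "(z, y) \<in> topspace ?ZX"
        using zy compactin_subset_topspace[OF C] by blast
      then have "y = x" "\<bar>\<phi> (c x) z\<bar> > real (d x)"
        using nz by (auto simp: F_def h_def split: if_splits)
      moreover have "\<bar>\<phi> (c x) z\<bar> \<le> real (N (c x))"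
        using zy by (intro N) force
      ultimately show "x \<in> (\<lambda>x. (c x, d x)) -` ?I \<inter> S"
        using x zy by force
    qed
    ultimately show ?thesis
      by (rule rev_finite_subset)
  qed
  have F: "continuous_map ?Y (compact_open_topology ?ZX) F"
  proof (rule continuous_map_into_compact_open_topology)
    fix C U assume C: "compactin ?ZX C" and "open (U :: real set)"
    \<comment> \<open>Openness in \<open>?Y\<close> is a condition only on sets containing
      \<open>p\<close>. Since \<open>F p\<close> vanishes on \<open>C\<close>, an \<open>F x\<close>
      that leaves \<open>U\<close> on \<open>C\<close> must be nonzero somewhere on
      \<open>C\<close>.\<close>
    have "finite {x \<in> S. \<not> F x ` C \<subseteq> U}" if "F p ` C \<subseteq> U"
    proof (rule finite_subset[OF _ finite_support[OF C]], clarify)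
      fix x q assume "x \<in> S" "q \<in> C" "F x q \<notin> U"
      moreover have "F p q = 0"
        using compactin_subset_topspace[OF C] \<open>q \<in> C\<close> p by (auto simp: F_def h_def)
      ultimately show "\<exists>q\<in>C. F x q \<noteq> 0"
        using that by force
    qed
    moreover have "S - {y \<in> topspace ?Y. F y ` C \<subseteq> U} = {x \<in> S. \<not> F x ` C \<subseteq> U}"
      by auto
    ultimately show "openin ?Y {y \<in> topspace ?Y. F y ` C \<subseteq> U}"
      by (auto simp: openin_fan set_diff_eq)
  qed (rule F_cont)
  define K where "K = F ` topspace ?Y"
  have "compactin (compact_open_topology ?ZX) K"
    unfolding K_def using compact_space_fan_const[of S p]
    by (intro image_compactin[OF _ F]) (simp only: compact_space_def)
  then have ev: "continuous_map (prod_topology ?ZX (subtopology (compact_open_topology ?ZX) K))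
      euclideanreal (\<lambda>(q, f). f q)"
    using \<open>Ascoli_space ?ZX\<close> by (simp add: Ascoli_space_def evenly_continuous_def)
  have "continuous_map ?Y (subtopology (compact_open_topology ?ZX) K) F"
    using F by (auto simp: continuous_map_in_subtopology K_def)
  then have "continuous_map (prod_topology ?ZX ?Y)
      (prod_topology ?ZX (subtopology (compact_open_topology ?ZX) K)) (\<lambda>w. (fst w, F (snd w)))"
    using continuous_map_compose[OF continuous_map_snd]
    by (intro continuous_map_pairedI continuous_map_fst) (simp add: o_def)
  from continuous_map_compose[OF this ev]
  have "continuous_map (prod_topology ?ZX ?Y) euclideanreal (\<lambda>w. F (snd w) (fst w))"
    by (simp add: o_def)
  moreover have "((z0, p), p) \<in> topspace (prod_topology ?ZX ?Y)"
    using z0 by simp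
  ultimately obtain W where W: "openin (prod_topology ?ZX ?Y) W" "((z0, p), p) \<in> W"
    "\<And>w. w \<in> W \<Longrightarrow> \<bar>F (snd w) (fst w) - F p (z0, p)\<bar> < 1"
    unfolding continuous_map_euclideanreal_iff by (metis fst_conv snd_conv zero_less_one)
  then obtain A B where AB: "openin ?ZX A" "openin ?Y B" "(z0, p) \<in> A" "p \<in> B" "A \<times> B \<subseteq> W"
    unfolding openin_prod_topology_alt by meson
  then obtain U V where UV: "openin Z U" "openin ?X V" "z0 \<in> U" "p \<in> V" "U \<times> V \<subseteq> A"
    unfolding openin_prod_topology_alt by meson
  \<comment> \<open>The spine is chosen to be the one labelled by the neighbourhood \<open>U\<close>
    just obtained. \<open>V\<close> omits finitely many points of it and \<open>B\<close> omits
    finitely many points in all, so this infinite spine has a point in both.\<close>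
  have "finite {x \<in> S - V. c x = U}" "finite (S - B)"
    using UV AB by (auto simp: openin_fan set_diff_eq)
  then have "finite ({x \<in> S - V. c x = U} \<union> (S - B))"
    by simp
  then have "\<not> {x \<in> S. c x = U} \<subseteq> {x \<in> S - V. c x = U} \<union> (S - B)"
    using spine[OF UV(1,3)] finite_subset by blast
  then obtain x where x: "x \<in> S" "c x = U" "x \<in> V" "x \<in> B"
    by blast
  \<comment> \<open>The extra 1 offsets the cutoff: \<open>F x (z, x)\<close> exceeds 1, whereas
    \<open>F p (z0, p)\<close> is 0.\<close>
  obtain z where z: "z \<in> U" "\<bar>\<phi> U z\<bar> > real (d x) + 1"
    using unb[OF UV(1,3)] by (force simp: bounded_iff not_le)
  have "((z, x), x) \<in> W"
    using UV AB x z by blast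
  then have "\<bar>F x (z, x) - F p (z0, p)\<bar> < 1"
    using W(3) by force
  moreover have "z \<in> topspace Z"
    using z openin_subset[OF UV(1)] by blast
  ultimately show False
    using z x z0 p by (auto simp: F_def h_def)
qed

section \<open>Cardinality: placing the fan in the type \<open>'b\<close>\<close>

text \<open>For infinite \<open>T\<close>, neither the product of \<open>Pow T\<close> with the
  naturals nor one further point exceeds the cardinality of \<open>Pow T\<close>. Hence all pairs
  (U, n), with \<open>None\<close> for the apex, embed into \<open>'b\<close>; the coordinates
  invert this embedding. All subsets of \<open>T\<close> serve as labels, which includes the open
  sets of a topology on \<open>T\<close>.\<close>

lemma obtain_fan_coordinates:
  assumes inf: "infinite T" and le: "Pow T \<lesssim> (UNIV :: 'b set)"
  obtains S p and c :: "'b \<Rightarrow> 'a set" and d :: "'b \<Rightarrow> nat" where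
    "p \<notin> S" "inj_on (\<lambda>x. (c x, d x)) S" "\<And>U. U \<subseteq> T \<Longrightarrow> infinite {x \<in> S. c x = U}"
proof -
  let ?A = "Pow T \<times> (UNIV :: nat set)"
  have infP: "infinite (Pow T)" using inf by simp
  then have "(card_of (UNIV :: nat set), card_of (Pow T)) \<in> ordLeq"
    by (rule infinite_iff_card_of_nat[THEN iffD1])
  then have "(card_of ?A, card_of (Pow T)) \<in> ordIso"
    using infP by (intro card_of_Times_infinite_simps) auto
  then have A: "?A \<approx> Pow T"
    by (simp add: eqpoll_iff_card_of_ordIso)
  then have "infinite ?A"
    using infP eqpoll_finite_iff by blast
  then have "insert None (Some ` ?A) \<lesssim> Some ` ?A"
    by (intro infinite_insert_lepoll) (simp add: finite_image_iff)
  also have "Some ` ?A \<lesssim> ?A"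
    by (rule image_lepoll)
  also have "?A \<lesssim> Pow T"
    by (rule eqpoll_imp_lepoll[OF A])
  also note le
  finally have "insert None (Some ` ?A) \<lesssim> (UNIV :: 'b set)" .
  then obtain e :: "('a set \<times> nat) option \<Rightarrow> 'b" where e: "inj_on e (insert None (Some ` ?A))"
    by (auto simp: lepoll_def)
  define g where "g = e \<circ> Some"
  have g: "inj_on g ?A"
    unfolding g_def using e by (intro comp_inj_on) (auto intro: inj_on_subset)
  define k where "k = inv_into ?A g"
  have k: "k (g u) = u" if "u \<in> ?A" for u
    unfolding k_def using g that by (rule inv_into_f_f)
  show thesis
  proof
    show "e None \<notin> g ` ?A"
      using e by (auto simp: g_def inj_on_def)
    show "inj_on (\<lambda>x. ((fst \<circ> k) x, (snd \<circ> k) x)) (g ` ?A)"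
      by (auto simp: k intro!: inj_onI)
    fix U assume U: "U \<subseteq> T"
    have "inj (\<lambda>n. g (U, n))"
      using g U by (auto simp: inj_on_def)
    then have "infinite (range (\<lambda>n. g (U, n)))"
      by (simp add: finite_image_iff)
    moreover have "range (\<lambda>n. g (U, n)) \<subseteq> {x \<in> g ` ?A. (fst \<circ> k) x = U}"
      using U by (auto simp: k)
    ultimately show "infinite {x \<in> g ` ?A. (fst \<circ> k) x = U}"
      using finite_subset by blast
  qed
qed

lemma exists_not_Ascoli_space_prod:
  fixes Z :: "'a topology"
  assumes mu: "mu_space Z" and nlc: "\<not> locally_compact_space Z"
    and le: "Pow (topspace Z) \<lesssim> (UNIV :: 'b set)"
  shows "\<exists>X :: 'b topology. Tychonoff_space X \<and> Frechet_Urysohn_space X \<and>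
    \<not> Ascoli_space (prod_topology Z X)"
proof -
  obtain z0 where z0: "z0 \<in> topspace Z"
    "\<And>U K. openin Z U \<Longrightarrow> compactin Z K \<Longrightarrow> z0 \<in> U \<Longrightarrow> \<not> U \<subseteq> K"
    using nlc unfolding locally_compact_space_def by blast
  \<comment> \<open>A finite space would itself be a compact neighbourhood of
    \<open>z0\<close>.\<close>
  have "infinite (topspace Z)"
    using z0(2)[OF openin_topspace _ z0(1)] finite_imp_compactin[OF subset_refl] by blast
  then obtain S p and c :: "'b \<Rightarrow> 'a set" and d :: "'b \<Rightarrow> nat" where fan:
    "p \<notin> S" "inj_on (\<lambda>x. (c x, d x)) S"
    "\<And>U. U \<subseteq> topspace Z \<Longrightarrow> infinite {x \<in> S. c x = U}"
    using obtain_fan_coordinates[OF _ le] by metis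
  have "\<exists>f. continuous_map Z euclideanreal f \<and> (openin Z U \<longrightarrow> z0 \<in> U \<longrightarrow> \<not> bounded (f ` U))" for U
  proof (cases "openin Z U \<and> z0 \<in> U")
    case True
    \<comment> \<open>The closure of \<open>U\<close> contains \<open>U\<close>, so its compactness
      would contradict the choice of \<open>z0\<close>.\<close>
    then have "\<not> compactin Z (Z closure_of U)"
      using z0(2) closure_of_subset openin_subset by metis
    then have "\<not> functionally_bounded_in Z U"
      using mu by (auto simp: mu_space_def)
    then show ?thesis
      using True openin_subset by (auto simp: functionally_bounded_in_def)
  next
    case False
    \<comment> \<open>The zero function is a default that makes \<open>\<phi>\<close> continuous for
      every set \<open>U\<close>.\<close>
    then show ?thesis by (intro exI[of _ "\<lambda>_. 0"]) auto
  qed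
  then obtain \<phi> where "\<And>U. continuous_map Z euclideanreal (\<phi> U)"
    "\<And>U. openin Z U \<Longrightarrow> z0 \<in> U \<Longrightarrow> \<not> bounded (\<phi> U ` U)"
    by metis
  then have "\<not> Ascoli_space (prod_topology Z (fan S p c))"
    using fan z0(1) by (intro not_Ascoli_space_prod_fan[where \<phi> = \<phi> and d = d] fan(3)[OF openin_subset])
  then show ?thesis
    by (intro exI[of _ "fan S p c"] conjI Tychonoff_space_fan Frechet_Urysohn_space_fan)
qed

text \<open>The spaces X range over topologies on one fixed type \<open>'b\<close>. The return from
  (iii) to (i) constructs a fan with a spine for each subset of Z, so the equivalences are stated
  for \<open>'b\<close> at least as large as the power set of Z.\<close>

theorem theorem4p4:
  fixes Z :: "'a topology"
  assumes "Tychonoff_space Z" and "mu_space Z"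
  shows "let
      i = locally_compact_space Z;
      ii = (\<forall>X :: 'b topology. Ascoli_space X \<longrightarrow> Ascoli_space (prod_topology Z X));
      iii = (\<forall>X :: 'b topology. Tychonoff_space X \<and> Frechet_Urysohn_space X
               \<longrightarrow> Ascoli_space (prod_topology Z X))
    in (i \<longrightarrow> ii) \<and> (ii \<longrightarrow> iii) \<and>
       (Pow (topspace Z) \<lesssim> (UNIV :: 'b set) \<longrightarrow> (i \<longleftrightarrow> ii) \<and> (i \<longleftrightarrow> iii))"
proof -
  let ?i = "locally_compact_space Z"
  let ?ii = "\<forall>X :: 'b topology. Ascoli_space X \<longrightarrow> Ascoli_space (prod_topology Z X)"
  let ?iii = "\<forall>X :: 'b topology. Tychonoff_space X \<and> Frechet_Urysohn_space X
    \<longrightarrow> Ascoli_space (prod_topology Z X)"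
  have "?i \<longrightarrow> ?ii"
    using Ascoli_space_prod_locally_compact[OF assms(1)] by auto
  moreover have "?ii \<longrightarrow> ?iii"
    using Frechet_Urysohn_imp_Ascoli_space by auto
  moreover have "Pow (topspace Z) \<lesssim> (UNIV :: 'b set) \<longrightarrow> ?iii \<longrightarrow> ?i"
    using exists_not_Ascoli_space_prod[OF assms(2)] by auto
  ultimately show ?thesis
    unfolding Let_def by argo
qed

end
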